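(* Let $\{X_n\}_{n\ge 0}$ be a finite irreducible discrete time Markov chain with state space $\mathcal S=\{1,\dots,m\}$ and stationary distribution $\{\pi_j\}$. For $i=1,\dots,m$ and $|s|<1$, the probability generating functions $f_i(s)=\sum_{n=0}^\infty P\{T_i^{(0)}=n\mid X_0=i\}s^n$ and $g_i(s)=\sum_{n=0}^\infty P\{T_i^{(1)}=n\mid X_0=i\}s^n$ of the mixing times satisfy $$f_i(s)=\pi_i+\sum_{j\ne i}F_{ij}(s)\pi_j,\qquad g_i(s)=\sum_{j=1}^m \pi_jF_{ij}(s).$$
   Context: The mixing variable $M$ is a random variable, independent of the chain, with $P[M=j]=\pi_j$ for all $j\in\mathcal S$. Given $X_0=i$, $T_i^{(0)}=\min\{n\ge 0: X_n=M\}$ and $T_i^{(1)}=\min\{n\ge 1: X_n=M\}$. For $n\ge1$, $f_{ij}^{(n)}=P\{X_n=j,\ X_k\ne j \text{ for } k=1,\dots,n-1\mid X_0=i\}$, with $f_{ij}^{(0)}=0$, and $F_{ij}(s)=\sum_{n=0}^\infty f_{ij}^{(n)}s^n$. *)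

theory Defs
  imports "HOL-Probability.Probability"
begin

definition stochastic_matrix :: "'s set \<Rightarrow> ('s \<Rightarrow> 's \<Rightarrow> real) \<Rightarrow> bool" where
  "stochastic_matrix S p \<longleftrightarrow>
     (\<forall>i\<in>S. \<forall>j\<in>S. 0 \<le> p i j) \<and> (\<forall>i\<in>S. (\<Sum>j\<in>S. p i j) = 1)"

fun n_step :: "'s set \<Rightarrow> ('s \<Rightarrow> 's \<Rightarrow> real) \<Rightarrow> nat \<Rightarrow> 's \<Rightarrow> 's \<Rightarrow> real" where
  "n_step S p 0 i j = (if i = j then 1 else 0)"
| "n_step S p (Suc n) i j = (\<Sum>k\<in>S. p i k * n_step S p n k j)"

definition irreducible_matrix :: "'s set \<Rightarrow> ('s \<Rightarrow> 's \<Rightarrow> real) \<Rightarrow> bool" where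
  "irreducible_matrix S p \<longleftrightarrow> (\<forall>i\<in>S. \<forall>j\<in>S. \<exists>n. 0 < n_step S p n i j)"

definition stationary_distribution ::
    "'s set \<Rightarrow> ('s \<Rightarrow> 's \<Rightarrow> real) \<Rightarrow> ('s \<Rightarrow> real) \<Rightarrow> bool" where
  "stationary_distribution S p \<pi> \<longleftrightarrow>
     (\<forall>j\<in>S. 0 \<le> \<pi> j) \<and> (\<Sum>j\<in>S. \<pi> j) = 1 \<and>
     (\<forall>j\<in>S. (\<Sum>i\<in>S. \<pi> i * p i j) = \<pi> j)"

text \<open>Time-homogeneous chain with transition matrix \<open>p\<close> and arbitrary initial distribution. The
  Markov property is required only for histories of positive probability, since conditional
  probabilities given a null event are \<open>0\<close> by the library's convention.\<close>

definition markov_chain ::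
    "'w measure \<Rightarrow> 's set \<Rightarrow> ('s \<Rightarrow> 's \<Rightarrow> real) \<Rightarrow> (nat \<Rightarrow> 'w \<Rightarrow> 's) \<Rightarrow> bool" where
  "markov_chain \<Omega> S p X \<longleftrightarrow>
     prob_space \<Omega> \<and> stochastic_matrix S p \<and>
     (\<forall>n. X n \<in> \<Omega> \<rightarrow>\<^sub>M count_space S) \<and>
     (\<forall>n x j. j \<in> S \<longrightarrow> \<P>(\<omega> in \<Omega>. \<forall>k\<le>n. X k \<omega> = x k) > 0 \<longrightarrow>
        \<P>(\<omega> in \<Omega>. X (Suc n) \<omega> = j \<bar> \<forall>k\<le>n. X k \<omega> = x k) = p (x n) j)"

text \<open>Independence is from the whole trajectory, i.e. from the sigma-algebra generated by all
  \<open>X n\<close>.\<close>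

definition mixing_variable ::
    "'w measure \<Rightarrow> 's set \<Rightarrow> ('s \<Rightarrow> real) \<Rightarrow> (nat \<Rightarrow> 'w \<Rightarrow> 's) \<Rightarrow> ('w \<Rightarrow> 's) \<Rightarrow> bool" where
  "mixing_variable \<Omega> S \<pi> X M \<longleftrightarrow>
     M \<in> \<Omega> \<rightarrow>\<^sub>M count_space S \<and>
     prob_space.indep_set \<Omega>
       (sets (vimage_algebra (space \<Omega>) M (count_space S)))
       (sets (vimage_algebra (space \<Omega>) (\<lambda>\<omega> n. X n \<omega>) (\<Pi>\<^sub>M n\<in>UNIV. count_space S))) \<and>
     (\<forall>j\<in>S. \<P>(\<omega> in \<Omega>. M \<omega> = j) = \<pi> j)"

text \<open>\<open>mixing_time k X M\<close> is \<open>min {n \<ge> k. X n = M}\<close>, with value \<open>\<infinity>\<close> if there is no such \<open>n\<close>.\<close>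

definition mixing_time ::
    "nat \<Rightarrow> (nat \<Rightarrow> 'w \<Rightarrow> 's) \<Rightarrow> ('w \<Rightarrow> 's) \<Rightarrow> 'w \<Rightarrow> enat" where
  "mixing_time k X M \<omega> = Inf (enat ` {n. k \<le> n \<and> X n \<omega> = M \<omega>})"

definition first_passage_prob ::
    "'w measure \<Rightarrow> (nat \<Rightarrow> 'w \<Rightarrow> 's) \<Rightarrow> 's \<Rightarrow> 's \<Rightarrow> nat \<Rightarrow> real" where
  "first_passage_prob \<Omega> X i j n =
     (if n = 0 then 0
      else \<P>(\<omega> in \<Omega>. X n \<omega> = j \<and> (\<forall>k\<in>{1..n - 1}. X k \<omega> \<noteq> j) \<bar> X 0 \<omega> = i))"

text \<open>The type of the argument covers both real and complex \<open>s\<close>. All coefficient sequences used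
  below take values in \<open>[0, 1]\<close>, so the series converges for \<open>norm s < 1\<close>.\<close>

definition gen_fun :: "(nat \<Rightarrow> real) \<Rightarrow> 'a \<Rightarrow> 'a::{real_normed_field, banach}" where
  "gen_fun a s = (\<Sum>n. of_real (a n) * s ^ n)"

definition first_passage_gf ::
    "'w measure \<Rightarrow> (nat \<Rightarrow> 'w \<Rightarrow> 's) \<Rightarrow> 's \<Rightarrow> 's \<Rightarrow> 'a \<Rightarrow> 'a::{real_normed_field, banach}" where
  "first_passage_gf \<Omega> X i j = gen_fun (first_passage_prob \<Omega> X i j)"

definition mixing_time_gf ::
    "nat \<Rightarrow> 'w measure \<Rightarrow> (nat \<Rightarrow> 'w \<Rightarrow> 's) \<Rightarrow> ('w \<Rightarrow> 's) \<Rightarrow> 's \<Rightarrow> 'a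
      \<Rightarrow> 'a::{real_normed_field, banach}" where
  "mixing_time_gf k \<Omega> X M i =
     gen_fun (\<lambda>n. \<P>(\<omega> in \<Omega>. mixing_time k X M \<omega> = enat n \<bar> X 0 \<omega> = i))"

end

theory Submission
  imports Defs
begin

text \<open>Conditioning on \<open>M = j\<close>, which is independent of the trajectory, turns the mixing time
  into the hitting time of \<open>j\<close>; its law given \<open>X 0 = i\<close> is \<open>first_passage_prob \<Omega> X i j\<close>, except
  that for \<open>k = 0\<close> and \<open>j = i\<close> the time is \<open>0\<close>. Comparing power series coefficientwise gives both
  formulas.\<close>

text \<open>A nonempty set of extended naturals attains its infimum, and the empty set has infimum
  \<infinity>, so a finite value can only arise as a minimum.\<close>

lemma Inf_enat_image_eq_iff: "Inf (enat ` A) = enat n \<longleftrightarrow> n \<in> A \<and> (\<forall>l\<in>A. n \<le> l)"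
proof
  assume inf: "Inf (enat ` A) = enat n"
  then have "enat ` A \<noteq> {}"
    by (auto simp: Inf_enat_def)
  then have "Inf (enat ` A) \<in> enat ` A"
    unfolding Inf_enat_def by (simp, metis LeastI ex_in_conv)
  then have "n \<in> A"
    using inf by auto
  moreover have "n \<le> l" if "l \<in> A" for l
    using Inf_lower[of "enat l" "enat ` A"] that inf by simp
  ultimately show "n \<in> A \<and> (\<forall>l\<in>A. n \<le> l)"
    by blast
next
  assume "n \<in> A \<and> (\<forall>l\<in>A. n \<le> l)"
  then show "Inf (enat ` A) = enat n"
    by (intro antisym Inf_lower Inf_greatest) auto
qed

text \<open>In this form the event depends on \<open>M\<close> and finitely many coordinates of the
  trajectory, so for a fixed value of \<open>M\<close> it is measurable in the product
  space.\<close>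

lemma mixing_time_eq_enat_iff:
  "mixing_time k X M \<omega> = enat n \<longleftrightarrow> k \<le> n \<and> X n \<omega> = M \<omega> \<and> (\<forall>l\<in>{k..<n}. X l \<omega> \<noteq> M \<omega>)"
  unfolding mixing_time_def Inf_enat_image_eq_iff by (fastforce simp: not_less)

text \<open>Total probability over the values of \<open>Z\<close>: on \<open>Z = j\<close> the event
  depends on the trajectory alone, and independence splits off the factor
  \<open>\<pi> j\<close>.\<close>

lemma (in prob_space) mixing_variable_prob_eq_sum:
  assumes fin: "finite S" and X: "\<And>n. X n \<in> M \<rightarrow>\<^sub>M count_space S"
    and Z: "mixing_variable M S \<pi> X Z"
    and Q: "\<And>j. j \<in> S \<Longrightarrow> Measurable.pred (\<Pi>\<^sub>M n\<in>UNIV. count_space S) (Q j)"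
  shows "\<P>(\<omega> in M. Q (Z \<omega>) (\<lambda>n. X n \<omega>)) = (\<Sum>j\<in>S. \<pi> j * \<P>(\<omega> in M. Q j (\<lambda>n. X n \<omega>)))"
proof -
  let ?N = "\<Pi>\<^sub>M n\<in>UNIV. count_space S" and ?X = "\<lambda>\<omega> n. X n \<omega>"
  have Zm: "Z \<in> M \<rightarrow>\<^sub>M count_space S"
    and ind: "indep_set (sets (vimage_algebra (space M) Z (count_space S)))
      (sets (vimage_algebra (space M) ?X ?N))"
    and dist: "\<And>j. j \<in> S \<Longrightarrow> \<P>(\<omega> in M. Z \<omega> = j) = \<pi> j"
    using Z unfolding mixing_variable_def by auto
  have Xm: "?X \<in> M \<rightarrow>\<^sub>M ?N"
    using measurable_space[OF X] by (intro measurable_PiM_single' X) auto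
  have Z_ev: "{\<omega> \<in> space M. Z \<omega> = j} = Z -` {j} \<inter> space M" for j
    by auto
  have Q_ev: "{\<omega> \<in> space M. Q j (?X \<omega>)} = ?X -` {f \<in> space ?N. Q j f} \<inter> space M" for j
    using measurable_space[OF Xm] by auto
  have joint: "\<P>(\<omega> in M. Z \<omega> = j \<and> Q j (?X \<omega>)) = \<pi> j * \<P>(\<omega> in M. Q j (?X \<omega>))"
    if j: "j \<in> S" for j
  proof -
    have "{\<omega> \<in> space M. Z \<omega> = j} \<in> sets (vimage_algebra (space M) Z (count_space S))"
      unfolding Z_ev using j by (intro in_vimage_algebra) auto
    \<comment> \<open>Independence is only given on the generated sigma-algebras, so membership in
      \<open>events\<close> would not be enough here.\<close>
    moreover have "{\<omega> \<in> space M. Q j (?X \<omega>)} \<in> sets (vimage_algebra (space M) ?X ?N)"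
      unfolding Q_ev using Q[OF j] by (intro in_vimage_algebra) (auto simp: pred_def)
    ultimately have "prob ({\<omega> \<in> space M. Z \<omega> = j} \<inter> {\<omega> \<in> space M. Q j (?X \<omega>)})
        = prob {\<omega> \<in> space M. Z \<omega> = j} * prob {\<omega> \<in> space M. Q j (?X \<omega>)}"
      by (rule indep_setD[OF ind])
    moreover have "{\<omega> \<in> space M. Z \<omega> = j} \<inter> {\<omega> \<in> space M. Q j (?X \<omega>)}
        = {\<omega> \<in> space M. Z \<omega> = j \<and> Q j (?X \<omega>)}"
      by auto
    ultimately show ?thesis
      by (simp only: dist[OF j])
  qed
  have ev: "{\<omega> \<in> space M. Z \<omega> = j \<and> Q j (?X \<omega>)} \<in> events" if j: "j \<in> S" for j
  proof (rule sets.sets_Collect_conj)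
    show "{\<omega> \<in> space M. Z \<omega> = j} \<in> events"
      unfolding Z_ev using Zm j by (intro measurable_sets) auto
    show "{\<omega> \<in> space M. Q j (?X \<omega>)} \<in> events"
      unfolding Q_ev using Xm Q[OF j] by (intro measurable_sets) (auto simp: pred_def)
  qed
  \<comment> \<open>\<open>Z\<close> takes all its values in \<open>S\<close>, so the finitely many
    disjoint pieces cover the event.\<close>
  have "{\<omega> \<in> space M. Q (Z \<omega>) (?X \<omega>)} = (\<Union>j\<in>S. {\<omega> \<in> space M. Z \<omega> = j \<and> Q j (?X \<omega>)})"
    using measurable_space[OF Zm] by auto
  then have "\<P>(\<omega> in M. Q (Z \<omega>) (?X \<omega>)) = (\<Sum>j\<in>S. \<P>(\<omega> in M. Z \<omega> = j \<and> Q j (?X \<omega>)))"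
    using fin ev by (auto simp: disjoint_family_on_def intro!: finite_measure_finite_Union)
  also have "\<dots> = (\<Sum>j\<in>S. \<pi> j * \<P>(\<omega> in M. Q j (?X \<omega>)))"
    by (intro sum.cong refl joint)
  finally show ?thesis .
qed

lemma (in prob_space) mixing_time_cond_prob:
  assumes fin: "finite S" and X: "\<And>n. X n \<in> M \<rightarrow>\<^sub>M count_space S"
    and Z: "mixing_variable M S \<pi> X Z" and i: "i \<in> S" and "k \<le> n"
  shows "\<P>(\<omega> in M. mixing_time k X Z \<omega> = enat n \<bar> X 0 \<omega> = i)
    = (\<Sum>j\<in>S. \<pi> j * \<P>(\<omega> in M. X n \<omega> = j \<and> (\<forall>l\<in>{k..<n}. X l \<omega> \<noteq> j) \<bar> X 0 \<omega> = i))"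
proof -
  \<comment> \<open>The condition \<open>X 0 = i\<close> is itself a trajectory event and is put
    into \<open>?Q\<close>; dividing the resulting sum by its probability yields the conditional
    statement.\<close>
  let ?Q = "\<lambda>j f. (f n = j \<and> (\<forall>l\<in>{k..<n}. f l \<noteq> j)) \<and> f 0 = i"
  have eq: "Measurable.pred (\<Pi>\<^sub>M n\<in>UNIV. count_space S) (\<lambda>f. f l = j)" if "j \<in> S" for l :: nat and j
    by (rule measurable_compose[OF measurable_component_singleton]) auto
  have "Measurable.pred (\<Pi>\<^sub>M n\<in>UNIV. count_space S) (?Q j)" if "j \<in> S" for j
    using eq[OF that] eq[OF i] by (intro pred_intros_logic pred_intros_finite) auto
  then show ?thesis
    using mixing_variable_prob_eq_sum[OF fin X Z, of ?Q] \<open>k \<le> n\<close>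
    by (simp add: cond_prob_def mixing_time_eq_enat_iff sum_divide_distrib)
qed

text \<open>Positivity matters for \<open>j = i\<close>: given a null event the conditional
  probability would be 0 by convention instead of 1.\<close>

lemma (in prob_space) cond_prob_initial_state:
  assumes "\<P>(\<omega> in M. X 0 \<omega> = i) > 0"
  shows "\<P>(\<omega> in M. X 0 \<omega> = j \<bar> X 0 \<omega> = i) = (if j = i then 1 else 0)"
proof -
  have "{\<omega> \<in> space M. X 0 \<omega> = j \<and> X 0 \<omega> = i} = {\<omega> \<in> space M. j = i \<and> X 0 \<omega> = i}"
    by auto
  then show ?thesis
    using assms by (simp add: cond_prob_def)
qed

lemma (in prob_space) mixing_time_1_cond_prob:
  assumes "finite S" "\<And>n. X n \<in> M \<rightarrow>\<^sub>M count_space S" "mixing_variable M S \<pi> X Z" "i \<in> S"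
  shows "\<P>(\<omega> in M. mixing_time 1 X Z \<omega> = enat n \<bar> X 0 \<omega> = i)
    = (\<Sum>j\<in>S. \<pi> j * first_passage_prob M X i j n)"
proof (cases "n = 0")
  \<comment> \<open>Both sides vanish: a time that is at least 1 is never 0, and the first passage
    probability at 0 is 0 by definition.\<close>
  case True
  then show ?thesis
    by (simp add: first_passage_prob_def cond_prob_def mixing_time_eq_enat_iff)
next
  case False
  then have "{1..<n} = {1..n - 1}"
    by auto
  then show ?thesis
    using False mixing_time_cond_prob[OF assms, of 1 n] by (simp add: first_passage_prob_def)
qed

text \<open>Given \<open>X 0 = i\<close>, the target \<open>j = i\<close> is hit at time 0 and
  contributes only there, while a target \<open>j \<noteq> i\<close> cannot be hit at time 0, so its
  hitting time is the first passage time.\<close>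

lemma (in prob_space) mixing_time_0_cond_prob:
  assumes fin: "finite S" and X: "\<And>n. X n \<in> M \<rightarrow>\<^sub>M count_space S"
    and Z: "mixing_variable M S \<pi> X Z" and i: "i \<in> S"
    and pos: "\<P>(\<omega> in M. X 0 \<omega> = i) > 0"
  shows "\<P>(\<omega> in M. mixing_time 0 X Z \<omega> = enat n \<bar> X 0 \<omega> = i)
    = (if n = 0 then \<pi> i else 0) + (\<Sum>j\<in>S - {i}. \<pi> j * first_passage_prob M X i j n)"
proof (cases "n = 0")
  case True
  then show ?thesis
    using mixing_time_cond_prob[OF fin X Z i, of 0 0] fin i
    by (simp add: cond_prob_initial_state[of X, OF pos] first_passage_prob_def if_distrib
        cong: if_cong)
next
  case False
  let ?P = "\<lambda>j. \<P>(\<omega> in M. X n \<omega> = j \<and> (\<forall>l\<in>{0..<n}. X l \<omega> \<noteq> j) \<bar> X 0 \<omega> = i)"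
  \<comment> \<open>For \<open>n > 0\<close> the index \<open>l = 0\<close> demands
    \<open>X 0 \<noteq> i\<close>, against the conditioning.\<close>
  have "{\<omega> \<in> space M. (X n \<omega> = i \<and> (\<forall>l\<in>{0..<n}. X l \<omega> \<noteq> i)) \<and> X 0 \<omega> = i} = {}"
    using False by auto
  then have "?P i = 0"
    by (simp only: cond_prob_def measure_empty div_0)
  moreover have "?P j = first_passage_prob M X i j n" if "j \<noteq> i" for j
  proof -
    \<comment> \<open>The additional index 0 imposes nothing, since \<open>X 0 = i\<close> and
      \<open>i \<noteq> j\<close>.\<close>
    have "{0..<n} = insert 0 {1..n - 1}"
      using False by auto
    then have "{\<omega> \<in> space M. (X n \<omega> = j \<and> (\<forall>l\<in>{0..<n}. X l \<omega> \<noteq> j)) \<and> X 0 \<omega> = i}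
        = {\<omega> \<in> space M. (X n \<omega> = j \<and> (\<forall>l\<in>{1..n - 1}. X l \<omega> \<noteq> j)) \<and> X 0 \<omega> = i}"
      using that by auto
    then show ?thesis
      using False by (simp add: cond_prob_def first_passage_prob_def)
  qed
  ultimately have "(\<Sum>j\<in>S. \<pi> j * ?P j) = (\<Sum>j\<in>S - {i}. \<pi> j * first_passage_prob M X i j n)"
    using fin i by (simp add: sum.remove[of S i])
  then show ?thesis
    using False mixing_time_cond_prob[OF fin X Z i, of 0 n] by simp
qed

text \<open>The coefficients are bounded by 1, so the geometric series in \<open>norm s\<close>
  dominates. Convergence is what permits adding the series termwise later.\<close>

lemma (in prob_space) gen_fun_first_passage_prob_sums:
  fixes s :: "'b::{real_normed_field, banach}"
  assumes X: "\<And>n. X n \<in> M \<rightarrow>\<^sub>M count_space S" and i: "i \<in> S" and s: "norm s < 1"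
  shows "(\<lambda>n. of_real (first_passage_prob M X i j n) * s ^ n) sums first_passage_gf M X i j s"
proof -
  have ev: "{\<omega> \<in> space M. X 0 \<omega> = i} \<in> events"
  proof -
    have "{\<omega> \<in> space M. X 0 \<omega> = i} = X 0 -` {i} \<inter> space M"
      by auto
    then show ?thesis
      using X[of 0] i by (simp add: measurable_sets)
  qed
  have bound: "\<bar>\<P>(\<omega> in M. P \<omega> \<bar> X 0 \<omega> = i)\<bar> \<le> 1" for P
  proof -
    have "prob {\<omega> \<in> space M. P \<omega> \<and> X 0 \<omega> = i} \<le> prob {\<omega> \<in> space M. X 0 \<omega> = i}"
      using ev by (intro finite_measure_mono) auto
    \<comment> \<open>If the conditioning event is null, the quotient is 0 and the bound still
      holds.\<close>
    then show ?thesis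
      by (simp add: cond_prob_def divide_le_eq_1 zero_less_measure_iff)
  qed
  have "\<bar>first_passage_prob M X i j n\<bar> \<le> 1" for n
    unfolding first_passage_prob_def by (simp add: bound del: abs_divide)
  then have "norm (of_real (first_passage_prob M X i j n) * s ^ n) \<le> norm s ^ n" for n
    by (simp add: norm_mult norm_power mult_left_le_one_le)
  moreover have "summable (\<lambda>n. norm s ^ n)"
    using s by (simp add: summable_geometric)
  ultimately have "summable (\<lambda>n. of_real (first_passage_prob M X i j n) * s ^ n)"
    by (metis (no_types, lifting) summable_comparison_test')
  then show ?thesis
    unfolding first_passage_gf_def gen_fun_def by (rule summable_sums)
qed

theorem theorem2p2:
  fixes \<Omega> :: "'w measure" and m i :: nat
    and p :: "nat \<Rightarrow> nat \<Rightarrow> real" and \<pi> :: "nat \<Rightarrow> real"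
    and X :: "nat \<Rightarrow> 'w \<Rightarrow> nat" and M :: "'w \<Rightarrow> nat"
    and s :: "'a::{real_normed_field, banach}"
  assumes "markov_chain \<Omega> {1..m} p X"
    and "irreducible_matrix {1..m} p"
    and "stationary_distribution {1..m} p \<pi>"
    and "mixing_variable \<Omega> {1..m} \<pi> X M"
    and "i \<in> {1..m}"
    and "\<P>(\<omega> in \<Omega>. X 0 \<omega> = i) > 0"
    and "norm s < 1"
  shows "mixing_time_gf 0 \<Omega> X M i s =
           of_real (\<pi> i) + (\<Sum>j\<in>{1..m} - {i}. first_passage_gf \<Omega> X i j s * of_real (\<pi> j))
       \<and> mixing_time_gf 1 \<Omega> X M i s =
           (\<Sum>j\<in>{1..m}. of_real (\<pi> j) * first_passage_gf \<Omega> X i j s)"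
proof -
  interpret prob_space \<Omega>
    using assms(1) unfolding markov_chain_def by blast
  have X: "\<And>n. X n \<in> \<Omega> \<rightarrow>\<^sub>M count_space {1..m}"
    using assms(1) unfolding markov_chain_def by blast
  have fp: "(\<lambda>n. of_real (\<pi> j * first_passage_prob \<Omega> X i j n) * s ^ n)
      sums (of_real (\<pi> j) * first_passage_gf \<Omega> X i j s)" for j
    using sums_mult[OF gen_fun_first_passage_prob_sums[where j = j, OF X assms(5,7)],
        of "of_real (\<pi> j)"]
    by (simp add: mult.assoc)
  have fp_sum: "(\<lambda>n. of_real (\<Sum>j\<in>A. \<pi> j * first_passage_prob \<Omega> X i j n) * s ^ n)
      sums (\<Sum>j\<in>A. of_real (\<pi> j) * first_passage_gf \<Omega> X i j s)" for A
    using sums_sum[of A, OF fp] by (simp only: of_real_sum sum_distrib_right)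
  \<comment> \<open>The constant \<open>\<pi> i\<close> is written as a power series so that it can
    be added to the others coefficient by coefficient.\<close>
  have "(\<lambda>n. of_real (if n = 0 then \<pi> i else 0) * s ^ n) sums of_real (\<pi> i)"
    using sums_If_finite_set[of "{0}" "\<lambda>n. of_real (\<pi> i) * s ^ n"]
    by (simp add: if_distrib[of of_real] if_distrib[of "\<lambda>x. x * _"] cong: if_cong)
  from sums_add[OF this fp_sum[of "{1..m} - {i}"]]
  have "mixing_time_gf 0 \<Omega> X M i s
      = of_real (\<pi> i) + (\<Sum>j\<in>{1..m} - {i}. of_real (\<pi> j) * first_passage_gf \<Omega> X i j s)"
    unfolding mixing_time_gf_def gen_fun_def
      mixing_time_0_cond_prob[OF finite_atLeastAtMost X assms(4-6)] of_real_add distrib_right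
    by (rule sums_unique[symmetric])
  moreover have "mixing_time_gf 1 \<Omega> X M i s
      = (\<Sum>j\<in>{1..m}. of_real (\<pi> j) * first_passage_gf \<Omega> X i j s)"
    unfolding mixing_time_gf_def gen_fun_def
      mixing_time_1_cond_prob[OF finite_atLeastAtMost X assms(4,5)]
    using fp_sum by (rule sums_unique[symmetric])
  ultimately show ?thesis
    \<comment> \<open>The first formula is stated with \<open>\<pi> j\<close> as the right factor;
      fixing the left factor in the commutativity rule orients the rewriting.\<close>
    by (simp only: mult.commute[of "first_passage_gf \<Omega> X i _ s"] simp_thms)
qed

end
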